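(* Let $a,b>0$. For every $c>0$ and $0<t<1$ we have $$e_c(a,b)(t)=\frac{t^{b/a-1}}{[a\Gamma(b)]^c}\,\frac{[\log(1/t)]^{c-1}}{\Gamma(c)}+\mathcal{O}\left(t^{b/a-1}[\log(1/t)]^{c-2}\right),\quad t\to 0.$$
   Context: For $a,b,c>0$, $$e_c(a,b)(t)=\frac{1}{2\pi}\int_{-\infty}^\infty t^{ix-1}[\Gamma(b-iax)/\Gamma(b)]^c\,dx,\quad t>0.$$ Here $[\Gamma(z)/\Gamma(b)]^c:=\exp(c\log\Gamma(z)-c\log\Gamma(b))$, where $\log\Gamma$ is the holomorphic branch on $\mathbb{C}\setminus(-\infty,0]$ of the logarithm of $\Gamma$ that is $0$ at $z=1$. The parameters $a,b,c$ are fixed in the asymptotic statement (the constant in $\mathcal{O}$ may depend on them). *)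

theory Defs
  imports "HOL-Analysis.Analysis" "HOL-Library.Landau_Symbols"
begin

text \<open>
  On complex arguments, \<^const>\<open>ln_Gamma\<close> is holomorphic off the nonpositive reals
  (\<open>holomorphic_ln_Gamma\<close>), a logarithm of \<^const>\<open>Gamma\<close> (\<open>Gamma_complex_altdef\<close>) and
  vanishes at 1, as shown next; hence it is the branch of \<open>log \<Gamma>\<close> that defines the power
  \<open>[\<Gamma>(z)/\<Gamma>(b)]\<^sup>c\<close>. It is in general not the principal logarithm of \<open>\<Gamma>(z)\<close>.
\<close>

lemma ln_Gamma_complex_1: "ln_Gamma (1 :: complex) = 0"
proof -
  have "ln_Gamma (complex_of_real 1) = of_real (ln_Gamma (1 :: real))"
    by (rule ln_Gamma_complex_of_real) simp
  also have "ln_Gamma (1 :: real) = ln (Gamma 1)"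
    by (rule ln_Gamma_real_pos) simp
  finally show ?thesis by simp
qed

definition Gamma_quot_pow :: "real \<Rightarrow> real \<Rightarrow> complex \<Rightarrow> complex" where
  "Gamma_quot_pow c b z = exp (of_real c * ln_Gamma z - of_real c * ln_Gamma (of_real b))"

text \<open>
  For positive parameters and \<open>t > 0\<close> the integral converges absolutely, since \<open>\<Gamma>\<close> decays
  exponentially along vertical lines. Its value is kept complex, as the formula gives it.
\<close>

definition e_density :: "real \<Rightarrow> real \<Rightarrow> real \<Rightarrow> real \<Rightarrow> complex" where
  "e_density c a b t =
     1 / (2 * of_real pi) *
     (CLBINT x. of_real t powr (\<i> * of_real x - 1) *
        Gamma_quot_pow c b (of_real b - \<i> * of_real a * of_real x))"

end

theory Submission
  imports Defs "HOL-Complex_Analysis.Complex_Analysis" "HOL-Probability.Sinc_Integral"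
begin

text \<open>
  Put \<open>x = ln (1/t) / a\<close> and substitute \<open>z = b - \<i>au\<close>: up to the factor
  \<open>t\<^bsup>b/a-1\<^esup> / (a \<Gamma>(b)\<^sup>c)\<close>, the density is the inverse Laplace transform of \<open>\<Gamma>(z)\<^sup>c\<close> at \<open>x\<close>,
  taken along the line \<open>Re z = b\<close>. Write \<open>\<Gamma>(z)\<^sup>c = z\<^bsup>-c\<^esup> G(z)\<close>, where \<open>G(z) = \<Gamma>(1 + z)\<^sup>c\<close> is
  holomorphic on \<open>Re z > -1\<close>, so that no contour has to go around the branch point at \<open>0\<close>.
  Expanding \<open>z\<^bsup>-c\<^esup>\<close> as the Laplace transform of \<open>s\<^bsup>c-1\<^esup> / \<Gamma>(c)\<close> turns the inverse transform into the
  convolution \<open>\<integral>\<^bsub>s>0\<^esub> s\<^bsup>c-1\<^esup> h(x - s) ds / \<Gamma>(c)\<close> with the inverse transform \<open>h\<close> of \<open>G\<close>. Moving the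
  line to \<open>Re z = -\<delta>\<close> shows that \<open>h\<close> decays exponentially in both directions, and, because of the
  residue \<open>G(0) = 1\<close> of \<open>G(z)/z\<close>, that \<open>\<integral>\<^bsub>s>0\<^esub> h(x - s) ds\<close> is exponentially close to \<open>1\<close>. Since
  \<open>h(x - s)\<close> concentrates at \<open>s = x\<close>, replacing \<open>s\<^bsup>c-1\<^esup>\<close> by \<open>x\<^bsup>c-1\<^esup>\<close> costs \<open>O(x\<^bsup>c-2\<^esup>)\<close>.
\<close>

section \<open>The Gamma function on vertical lines\<close>

text \<open>In Euler's integral \<open>t powr (z - 1)\<close> has modulus
  \<open>t powr (Re z - 1)\<close>, so the absolute value may be taken inside.\<close>

lemma norm_Gamma_le:
  fixes z :: complex
  assumes "Re z > 0"
  shows "norm (Gamma z) \<le> Gamma (Re z)"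
proof -
  have *: "norm (complex_of_real t powr (z - 1) / of_real (exp t)) \<le> t powr (Re z - 1) / exp t"
    if "t \<in> {0..}" for t :: real
    using that by (simp add: norm_divide norm_powr_real_powr)
  note I = Gamma_integral_complex[OF assms] Gamma_integral_real[OF assms]
  have "norm (integral {0..} (\<lambda>t. complex_of_real t powr (z - 1) / of_real (exp t))) \<le>
        integral {0..} (\<lambda>t. t powr (Re z - 1) / exp t)"
    by (rule integral_norm_bound_integral) (use I * in \<open>auto simp: has_integral_iff\<close>)
  thus ?thesis
    using I by (simp add: has_integral_iff)
qed

text \<open>Adding \<open>i \<ge> 0\<close> keeps the imaginary part and does not decrease the
  positive real part, so every factor of the Pochhammer product has modulus at least
  \<open>norm z\<close>.\<close>

lemma norm_power_le_norm_pochhammer: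
  fixes z :: complex
  assumes "Re z > 0"
  shows "norm z ^ n \<le> norm (pochhammer z n)"
proof -
  have "(\<Prod>i<n. norm z) \<le> (\<Prod>i<n. norm (z + of_nat i))"
  proof (rule prod_mono)
    fix i assume "i \<in> {..<n}"
    have "(Re z)\<^sup>2 \<le> (Re z + real i)\<^sup>2"
      using assms by (intro power_mono) auto
    thus "0 \<le> norm z \<and> norm z \<le> norm (z + of_nat i)"
      by (auto simp: cmod_def intro!: real_sqrt_le_mono)
  qed
  thus ?thesis
    by (simp add: pochhammer_prod prod_norm lessThan_atLeast0)
qed

text \<open>Decay comes from \<open>\<Gamma>(z) = \<Gamma>(z + N) / (z (z + 1) \<cdots> (z + N - 1))\<close>.\<close>

lemma Gamma_vertical_decay:
  assumes "0 < \<alpha>"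
  shows "\<exists>M>0. \<forall>z. \<alpha> \<le> Re z \<and> Re z \<le> \<beta> \<longrightarrow> norm (Gamma z) * norm z ^ N \<le> M"
proof -
  \<comment> \<open>The shifted argument \<open>z + N\<close> has its real part in this compact
    interval, which makes \<open>M\<close> independent of \<open>Im z\<close>.\<close>
  have "continuous_on {\<alpha> + real N..\<beta> + real N} (Gamma :: real \<Rightarrow> real)"
    using assms by (intro continuous_on_Gamma continuous_intros) (auto elim!: nonpos_Ints_cases)
  hence "bounded (Gamma ` {\<alpha> + real N..\<beta> + real N})"
    by (intro compact_imp_bounded compact_continuous_image) auto
  then obtain M where M: "M > 0" "\<And>x. x \<in> {\<alpha> + real N..\<beta> + real N} \<Longrightarrow> norm (Gamma x) \<le> M"
    by (auto simp: bounded_pos)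
  have "norm (Gamma z) * norm z ^ N \<le> M" if z: "\<alpha> \<le> Re z" "Re z \<le> \<beta>" for z
  proof -
    have pos: "Re z > 0"
      using z assms by simp
    hence ni: "z \<notin> \<int>\<^sub>\<le>\<^sub>0"
      by (auto elim!: nonpos_Ints_cases)
    have "norm (Gamma z) * norm z ^ N \<le> norm (Gamma z) * norm (pochhammer z N)"
      by (intro mult_left_mono norm_power_le_norm_pochhammer pos) auto
    also have "\<dots> = norm (Gamma (z + of_nat N))"
      using ni by (simp add: pochhammer_Gamma norm_divide Gamma_eq_zero_iff)
    also have "\<dots> \<le> Gamma (Re z + real N)"
      using norm_Gamma_le[of "z + of_nat N"] pos by simp
    also have "\<dots> \<le> M"
      using M(2)[of "Re z + real N"] z by simp
    finally show ?thesis .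
  qed
  thus ?thesis using M(1) by blast
qed

text \<open>The function \<open>G\<close> of the introduction. The power goes through
  \<open>ln_Gamma\<close> because a principal power of \<open>Gamma (1 + z)\<close> can jump where
  \<open>Gamma (1 + z)\<close> crosses the negative real axis.\<close>

definition Gamma_shift_pow :: "real \<Rightarrow> complex \<Rightarrow> complex" where
  "Gamma_shift_pow c z = exp (of_real c * ln_Gamma (1 + z))"

lemma Gamma_shift_pow_0 [simp]: "Gamma_shift_pow c 0 = 1"
  by (simp add: Gamma_shift_pow_def ln_Gamma_complex_1)

lemma holomorphic_Gamma_shift_pow: "Gamma_shift_pow c holomorphic_on {z. Re z > -1}"
  unfolding Gamma_shift_pow_def
  by (intro holomorphic_intros holomorphic_on_compose[of _ _ ln_Gamma, unfolded o_def])
     (auto simp: complex_nonpos_Reals_iff)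

text \<open>The exponent \<open>c\<close> is real, so the modulus depends only on the real part of
  the logarithm, which is the same for every branch.\<close>

lemma norm_Gamma_shift_pow:
  assumes "Re z > -1"
  shows "norm (Gamma_shift_pow c z) = norm (Gamma (1 + z)) powr c"
proof -
  have "1 + z \<notin> \<int>\<^sub>\<le>\<^sub>0"
    using assms by (auto elim!: nonpos_Ints_cases simp: complex_eq_iff)
  hence "norm (Gamma (1 + z)) = exp (Re (ln_Gamma (1 + z)))"
    by (simp add: Gamma_complex_altdef)
  thus ?thesis
    by (simp add: Gamma_shift_pow_def powr_def)
qed

text \<open>\<open>Gamma\<close> decays faster than any power on the strip, and so does its power
  with exponent \<open>c > 0\<close>. The weight is chosen for the line shifts:
  \<open>1 + (Im z)\<^sup>2\<close> secures integrability, and \<open>1 + norm z\<close> leaves room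
  for a factor of linear growth.\<close>

lemma Gamma_shift_pow_decay:
  assumes "c > 0" "\<alpha> > -1"
  obtains K where "K > 0"
    "\<And>z. \<alpha> \<le> Re z \<Longrightarrow> Re z \<le> \<beta> \<Longrightarrow>
       norm (Gamma_shift_pow c z) * ((1 + norm z) * (1 + (Im z)\<^sup>2)) \<le> K"
proof -
  define d where "d = 1 + \<alpha>"
  have d: "d > 0" using assms by (simp add: d_def)
  \<comment> \<open>The weight grows cubically, and decay of order \<open>N\<close> for
    \<open>Gamma\<close> becomes order \<open>N * c\<close> for the power, so
    \<open>N * c \<ge> 3\<close> is wanted.\<close>
  define N where "N = nat \<lceil>3 / c\<rceil>"
  have "3 / c \<le> real N" unfolding N_def by linarith
  hence N: "3 \<le> real N * c" using assms by (simp add: field_simps)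
  obtain M where M: "M > 0"
    "\<And>w. d \<le> Re w \<Longrightarrow> Re w \<le> 1 + \<beta> \<Longrightarrow> norm (Gamma w) * norm w ^ N \<le> M"
    using Gamma_vertical_decay[OF d, of "1 + \<beta>" N] by blast
  define K where "K = (1 + 2 / d) * (1 + 1 / d\<^sup>2) * (d ^ 3 / d powr (real N * c)) * M powr c"
  have "norm (Gamma_shift_pow c z) * ((1 + norm z) * (1 + (Im z)\<^sup>2)) \<le> K"
    if z: "\<alpha> \<le> Re z" "Re z \<le> \<beta>" for z
  proof -
    define r where "r = norm (1 + z)"
    have dr: "d \<le> r"
      using z complex_Re_le_cmod[of "1 + z"] by (simp add: r_def d_def)
    hence r: "r > 0" using d by simp
    have "norm z \<le> r + 1"
      using norm_triangle_ineq4[of "1 + z" 1] by (simp add: r_def)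
    hence "1 + norm z \<le> 2 + r" by simp
    also have "\<dots> \<le> (1 + 2 / d) * r"
      using dr d by (simp add: field_simps)
    finally have 1: "1 + norm z \<le> (1 + 2 / d) * r" .
    have "\<bar>Im z\<bar> \<le> r"
      using abs_Im_le_cmod[of "1 + z"] by (simp add: r_def)
    hence "1 + (Im z)\<^sup>2 \<le> 1 + r\<^sup>2"
      using power_mono[of "\<bar>Im z\<bar>" r 2] by simp
    also have "\<dots> \<le> (1 + 1 / d\<^sup>2) * r\<^sup>2"
      using power_mono[OF dr, of 2] d by (simp add: field_simps)
    finally have 2: "1 + (Im z)\<^sup>2 \<le> (1 + 1 / d\<^sup>2) * r\<^sup>2" .
    \<comment> \<open>Dividing by \<open>d\<close> makes the base at least 1, so raising the
      exponent from 3 to \<open>N * c\<close> cannot decrease the power.\<close>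
    have "(r / d) powr 3 \<le> (r / d) powr (real N * c)"
      using dr d N by (intro powr_mono) auto
    hence 3: "r ^ 3 \<le> d ^ 3 / d powr (real N * c) * r powr (real N * c)"
      using d r by (simp add: powr_divide field_simps)
    have "norm (Gamma (1 + z)) * r ^ N \<le> M"
      unfolding r_def using z by (intro M(2)) (auto simp: d_def)
    hence "(norm (Gamma (1 + z)) * r ^ N) powr c \<le> M powr c"
      using assms r by (intro powr_mono2) auto
    also have "(norm (Gamma (1 + z)) * r ^ N) powr c = norm (Gamma_shift_pow c z) * r powr (real N * c)"
      using r z assms by (simp add: powr_mult norm_Gamma_shift_pow powr_powr flip: powr_realpow)
    finally have 4: "norm (Gamma_shift_pow c z) * r powr (real N * c) \<le> M powr c" .
    have "norm (Gamma_shift_pow c z) * ((1 + norm z) * (1 + (Im z)\<^sup>2)) \<le>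
          norm (Gamma_shift_pow c z) * (((1 + 2 / d) * r) * ((1 + 1 / d\<^sup>2) * r\<^sup>2))"
      using 1 2 d r by (intro mult_left_mono mult_mono) auto
    also have "\<dots> = ((1 + 2 / d) * (1 + 1 / d\<^sup>2)) * (norm (Gamma_shift_pow c z) * r ^ 3)"
      by (simp add: power2_eq_square power3_eq_cube)
    also have "\<dots> \<le> ((1 + 2 / d) * (1 + 1 / d\<^sup>2)) *
        (norm (Gamma_shift_pow c z) * (d ^ 3 / d powr (real N * c) * r powr (real N * c)))"
      using 3 d by (intro mult_left_mono) auto
    also have "\<dots> = ((1 + 2 / d) * (1 + 1 / d\<^sup>2) * (d ^ 3 / d powr (real N * c))) *
        (norm (Gamma_shift_pow c z) * r powr (real N * c))"
      by simp
    also have "\<dots> \<le> K"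
      unfolding K_def using 4 d by (intro mult_left_mono) auto
    finally show ?thesis .
  qed
  moreover have "K > 0"
    unfolding K_def using d M by (intro mult_pos_pos add_pos_pos divide_pos_pos) auto
  ultimately show ?thesis using that by blast
qed

section \<open>Shifting vertical lines across a simple pole\<close>

lemma integrable_inverse_1_plus_square_lborel: "integrable lborel (\<lambda>x::real. 1 / (1 + x\<^sup>2))"
  using integrable_inverse_1_plus_square
  by (simp add: set_integrable_def field_simps)

lemma continuous_on_Complex_line: "continuous_on A (Complex \<sigma>)"
  by (intro continuous_intros)

lemma Complex_line_measurable [measurable]: "Complex \<sigma> \<in> borel \<rightarrow>\<^sub>M borel"
  by (intro borel_measurable_continuous_onI continuous_on_Complex_line)

lemma integrable_vertical_line:
  fixes g :: "complex \<Rightarrow> complex"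
  assumes cont: "continuous_on {z. Re z = \<sigma>} g"
    and decay: "\<And>x. norm (g (Complex \<sigma> x)) \<le> K / (1 + x\<^sup>2)"
  shows "integrable lborel (\<lambda>x. g (Complex \<sigma> x))"
proof (rule Bochner_Integration.integrable_bound)
  show "integrable lborel (\<lambda>x. K * (1 / (1 + x\<^sup>2)))"
    by (intro integrable_mult_right integrable_inverse_1_plus_square_lborel)
  have "continuous_on UNIV (\<lambda>x. g (Complex \<sigma> x))"
    by (rule continuous_on_compose2[OF cont continuous_on_Complex_line]) auto
  thus "(\<lambda>x. g (Complex \<sigma> x)) \<in> borel_measurable lborel"
    by (simp add: borel_measurable_continuous_onI)
  show "AE x in lborel. norm (g (Complex \<sigma> x)) \<le> norm (K * (1 / (1 + x\<^sup>2)))"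
    by (rule AE_I2) (use order_trans[OF decay abs_ge_self] in simp)
qed

text \<open>Dominated convergence. This links the gauge integrals that express contour integrals
  along segments to Lebesgue integrals over the whole line.\<close>

lemma integral_symmetric_intervals_tendsto:
  fixes f :: "real \<Rightarrow> complex"
  assumes "integrable lborel f"
  shows "(\<lambda>n. integral {-real n..real n} f) \<longlonglongrightarrow> (\<integral>x. f x \<partial>lborel)"
proof -
  have "(\<lambda>n. \<integral>x. indicator {-real n..real n} x *\<^sub>R f x \<partial>lborel) \<longlonglongrightarrow> (\<integral>x. f x \<partial>lborel)"
  proof (rule integral_dominated_convergence)
    show "integrable lborel (\<lambda>x. norm (f x))" using assms by simp
    show "AE x in lborel. (\<lambda>n. indicator {-real n..real n} x *\<^sub>R f x) \<longlonglongrightarrow> f x"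
    proof (rule AE_I2)
      fix x :: real
      have "eventually (\<lambda>n. indicator {-real n..real n} x *\<^sub>R f x = f x) sequentially"
        using eventually_ge_at_top[of "nat \<lceil>\<bar>x\<bar>\<rceil>"]
      proof eventually_elim
        case (elim n)
        hence "\<bar>x\<bar> \<le> real n" by linarith
        thus ?case by (auto simp: indicator_def)
      qed
      thus "(\<lambda>n. indicator {-real n..real n} x *\<^sub>R f x) \<longlonglongrightarrow> f x"
        by (rule tendsto_eventually)
    qed
  qed (use assms in \<open>auto simp: indicator_def\<close>)
  moreover have "(\<integral>x. indicator {-real n..real n} x *\<^sub>R f x \<partial>lborel) = integral {-real n..real n} f" for n
  proof -
    have "set_integrable lborel {-real n..real n} f"
      using assms unfolding set_integrable_def by (intro integrable_mult_indicator) auto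
    from set_borel_integral_eq_integral(2)[OF this] show ?thesis
      by (simp add: set_lebesgue_integral_def)
  qed
  ultimately show ?thesis by simp
qed

text \<open>Cauchy's integral formula on a growing rectangle whose vertical sides lie on the two
  lines. The pole 0 is inside, and the horizontal sides vanish in the limit. On the vertical sides
  \<open>dz = i dx\<close>, which cancels the \<open>\<i>\<close> of
  \<open>2 * pi * \<i> * g 0\<close>.\<close>

lemma vertical_line_shift:
  fixes g :: "complex \<Rightarrow> complex"
  assumes S: "open S" "convex S" "{z. \<sigma>1 \<le> Re z \<and> Re z \<le> \<sigma>2} \<subseteq> S"
    and holo: "g holomorphic_on S"
    and sig: "\<sigma>1 < 0" "0 < \<sigma>2"
    and decay: "\<And>z. \<sigma>1 \<le> Re z \<Longrightarrow> Re z \<le> \<sigma>2 \<Longrightarrow> norm (g z) \<le> K / (1 + (Im z)\<^sup>2)"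
  shows "(\<integral>x. g (Complex \<sigma>2 x) / Complex \<sigma>2 x \<partial>lborel) =
         (\<integral>x. g (Complex \<sigma>1 x) / Complex \<sigma>1 x \<partial>lborel) + 2 * pi * g 0"
proof -
  define q where "q = (\<lambda>z. g z / z)"
  have K: "K \<ge> 0"
    using order_trans[OF norm_ge_zero decay[of 0]] sig by simp
  have contg: "continuous_on {z. \<sigma>1 \<le> Re z \<and> Re z \<le> \<sigma>2} g"
    using holo S by (meson continuous_on_subset holomorphic_on_imp_continuous_on)
  have contq: "continuous_on ({z. \<sigma>1 \<le> Re z \<and> Re z \<le> \<sigma>2} - {0}) q"
    unfolding q_def by (intro continuous_intros continuous_on_subset[OF contg]) auto
  have int: "integrable lborel (\<lambda>x. q (Complex \<sigma> x))" if "\<sigma> = \<sigma>1 \<or> \<sigma> = \<sigma>2" for \<sigma>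
  proof (rule integrable_vertical_line[where K = "K / \<bar>\<sigma>\<bar>"])
    show "continuous_on {z. Re z = \<sigma>} q"
      using sig that by (intro continuous_on_subset[OF contq]) auto
    fix x :: real
    have "norm (q (Complex \<sigma> x)) = norm (g (Complex \<sigma> x)) / norm (Complex \<sigma> x)"
      by (simp add: q_def norm_divide)
    also have "\<dots> \<le> (K / (1 + x\<^sup>2)) / \<bar>\<sigma>\<bar>"
      using decay[of "Complex \<sigma> x"] abs_Re_le_cmod[of "Complex \<sigma> x"] that sig K
      by (intro frac_le) (auto simp: add_nonneg_pos)
    finally show "norm (q (Complex \<sigma> x)) \<le> K / \<bar>\<sigma>\<bar> / (1 + x\<^sup>2)"
      by (simp add: mult.commute)
  qed
  \<comment> \<open>\<open>V\<close> stands for a vertical side, with the factor \<open>\<i>\<close>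
    taken out; \<open>W\<close> collects the two horizontal sides.\<close>
  define V where "V = (\<lambda>\<sigma> n. integral {-real n..real n} (\<lambda>x. q (Complex \<sigma> x)))"
  define W where "W = (\<lambda>n. contour_integral (linepath (Complex \<sigma>1 (-real n)) (Complex \<sigma>2 (-real n))) q +
                           contour_integral (linepath (Complex \<sigma>2 (real n)) (Complex \<sigma>1 (real n))) q)"
  have rect: "W n + \<i> * (V \<sigma>2 n - V \<sigma>1 n) = 2 * pi * \<i> * g 0" and
       Wbound: "norm (W n) \<le> 2 * (\<sigma>2 - \<sigma>1) * K * (1 / (1 + (real n)\<^sup>2))" if n: "n > 0" for n
  proof -
    define R where "R = real n"
    have R: "R \<ge> 1" using n by (simp add: R_def)
    define p1 p2 p3 p4 where
      "p1 = Complex \<sigma>1 (-R)" "p2 = Complex \<sigma>2 (-R)" "p3 = Complex \<sigma>2 R" "p4 = Complex \<sigma>1 R"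
    note p_defs = this
    have rp: "rectpath p1 p3 = linepath p1 p2 +++ linepath p2 p3 +++ linepath p3 p4 +++ linepath p4 p1"
      by (simp add: rectpath_def p_defs Let_def)
    have "((\<lambda>w. g w / (w - 0)) has_contour_integral (2 * pi * \<i> * winding_number (rectpath p1 p3) 0 * g 0))
            (rectpath p1 p3)"
    proof (rule Cauchy_integral_formula_convex_simple[OF S(2) holo])
      show "0 \<in> interior S" using S sig by (auto simp: interior_open)
      have "path_image (rectpath p1 p3) \<subseteq> cbox p1 p3 - box p1 p3"
        using sig R by (subst path_image_rectpath_cbox_minus_box) (auto simp: p_defs)
      also have "\<dots> \<subseteq> S - {0}"
        using S(3) sig R by (auto simp: p_defs in_cbox_complex_iff in_box_complex_iff)
      finally show "path_image (rectpath p1 p3) \<subseteq> S - {0}" .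
    qed auto
    moreover have "winding_number (rectpath p1 p3) 0 = 1"
      using sig R by (intro winding_number_rectpath) (auto simp: p_defs in_box_complex_iff)
    ultimately have hci: "(q has_contour_integral (2 * pi * \<i> * g 0)) (rectpath p1 p3)"
      by (simp add: q_def)
    have ci: "q contour_integrable_on linepath p1 p2" "q contour_integrable_on linepath p2 p3"
      "q contour_integrable_on linepath p3 p4" "q contour_integrable_on linepath p4 p1"
      using sig R
      by (auto intro!: contour_integrable_continuous_linepath continuous_on_subset[OF contq]
        simp: p_defs closed_segment_same_Re closed_segment_same_Im closed_segment_eq_real_ivl)
    have "2 * pi * \<i> * g 0 = contour_integral (rectpath p1 p3) q"
      using contour_integral_unique[OF hci] by simp
    also have "\<dots> = contour_integral (linepath p1 p2) q + contour_integral (linepath p2 p3) q +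
        (contour_integral (linepath p3 p4) q + contour_integral (linepath p4 p1) q)"
      unfolding rp using ci by (simp add: add_ac)
    also have "contour_integral (linepath p2 p3) q = \<i> * V \<sigma>2 n"
      using R by (subst contour_integral_linepath_same_Re[of _ \<sigma>2 _ "-R" R]) (auto simp: p_defs V_def R_def)
    \<comment> \<open>The left side is traversed downwards, hence the minus sign in front of
      \<open>V \<sigma>1 n\<close>.\<close>
    also have "contour_integral (linepath p4 p1) q = - contour_integral (linepath p1 p4) q"
      using contour_integral_reversepath[of "linepath p1 p4" q] by simp
    also have "contour_integral (linepath p1 p4) q = \<i> * V \<sigma>1 n"
      using R by (subst contour_integral_linepath_same_Re[of _ \<sigma>1 _ "-R" R]) (auto simp: p_defs V_def R_def)
    finally show "W n + \<i> * (V \<sigma>2 n - V \<sigma>1 n) = 2 * pi * \<i> * g 0"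
      by (simp add: W_def algebra_simps p_defs R_def)
    \<comment> \<open>\<open>R \<ge> 1\<close> forces \<open>norm z \<ge> 1\<close> on the
      horizontal sides, so dividing by \<open>z\<close> does not worsen the bound on
      \<open>g\<close>.\<close>
    have qb: "norm (q z) \<le> K / (1 + R\<^sup>2)" if "\<sigma>1 \<le> Re z" "Re z \<le> \<sigma>2" "\<bar>Im z\<bar> = R" for z
    proof -
      have Im2: "(Im z)\<^sup>2 = R\<^sup>2" using that(3) by (metis power2_abs)
      have "1 \<le> norm z" using abs_Im_le_cmod[of z] that(3) R by linarith
      have "norm (q z) = norm (g z) / norm z" by (simp add: q_def norm_divide)
      also have "\<dots> \<le> (K / (1 + R\<^sup>2)) / 1"
        using decay[OF that(1,2)] \<open>1 \<le> norm z\<close> K unfolding Im2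
        by (intro frac_le) auto
      finally show ?thesis by simp
    qed
    have "norm (contour_integral (linepath p1 p2) q) \<le> K / (1 + R\<^sup>2) * norm (p2 - p1)"
      using sig R K ci
      by (intro contour_integral_bound_linepath qb)
         (auto simp: p_defs closed_segment_same_Im closed_segment_eq_real_ivl)
    moreover have "norm (contour_integral (linepath p3 p4) q) \<le> K / (1 + R\<^sup>2) * norm (p4 - p3)"
      using sig R K ci
      by (intro contour_integral_bound_linepath qb)
         (auto simp: p_defs closed_segment_same_Im closed_segment_eq_real_ivl)
    moreover have "norm (p2 - p1) = \<sigma>2 - \<sigma>1" "norm (p4 - p3) = \<sigma>2 - \<sigma>1"
      using sig by (auto simp: p_defs cmod_def)
    ultimately have "norm (contour_integral (linepath p1 p2) q + contour_integral (linepath p3 p4) q)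
        \<le> K / (1 + R\<^sup>2) * (\<sigma>2 - \<sigma>1) + K / (1 + R\<^sup>2) * (\<sigma>2 - \<sigma>1)"
      by (intro norm_triangle_mono) auto
    thus "norm (W n) \<le> 2 * (\<sigma>2 - \<sigma>1) * K * (1 / (1 + (real n)\<^sup>2))"
      by (simp add: W_def p_defs R_def mult_ac)
  qed
  have "(\<lambda>n. 2 * (\<sigma>2 - \<sigma>1) * K * (1 / (1 + (real n)\<^sup>2))) \<longlonglongrightarrow> 2 * (\<sigma>2 - \<sigma>1) * K * 0"
    by (intro tendsto_mult_left) real_asymp
  hence "W \<longlonglongrightarrow> 0"
    by (intro Lim_null_comparison[OF eventually_mono[OF eventually_gt_at_top[of 0] Wbound]]) auto
  moreover have "V \<sigma>1 \<longlonglongrightarrow> (\<integral>x. q (Complex \<sigma>1 x) \<partial>lborel)" "V \<sigma>2 \<longlonglongrightarrow> (\<integral>x. q (Complex \<sigma>2 x) \<partial>lborel)"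
    unfolding V_def by (intro integral_symmetric_intervals_tendsto int; simp)+
  ultimately have lim: "(\<lambda>n. W n + \<i> * (V \<sigma>2 n - V \<sigma>1 n)) \<longlonglongrightarrow>
      0 + \<i> * ((\<integral>x. q (Complex \<sigma>2 x) \<partial>lborel) - (\<integral>x. q (Complex \<sigma>1 x) \<partial>lborel))"
    by (intro tendsto_intros)
  have "(\<lambda>n. W n + \<i> * (V \<sigma>2 n - V \<sigma>1 n)) \<longlonglongrightarrow> 2 * pi * \<i> * g 0"
    by (rule tendsto_eventually[OF eventually_mono[OF eventually_gt_at_top[of 0] rect]])
  from LIMSEQ_unique[OF lim this]
  have "\<i> * ((\<integral>x. q (Complex \<sigma>2 x) \<partial>lborel) - (\<integral>x. q (Complex \<sigma>1 x) \<partial>lborel)) = \<i> * (2 * pi * g 0)"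
    by (simp add: mult_ac)
  hence "(\<integral>x. q (Complex \<sigma>2 x) \<partial>lborel) - (\<integral>x. q (Complex \<sigma>1 x) \<partial>lborel) = 2 * pi * g 0"
    by (simp only: mult_left_cancel[OF complex_i_not_zero])
  thus ?thesis
    by (simp add: q_def algebra_simps)
qed

section \<open>Laplace transforms of powers\<close>

text \<open>The truncated power, extended by zero so that Laplace transforms and convolutions run
  over all of \<open>lborel\<close>. \<open>pos_powr 1\<close> is the Heaviside function.\<close>

definition pos_powr :: "real \<Rightarrow> real \<Rightarrow> real" where
  "pos_powr d s = indicator {0<..} s * s powr (d - 1)"

lemma pos_powr_measurable [measurable]: "pos_powr d \<in> borel_measurable borel"
  unfolding pos_powr_def [abs_def] by measurable

lemma pos_powr_nonneg: "pos_powr d s \<ge> 0"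
  by (simp add: pos_powr_def)

lemma pos_powr_mult_power: "pos_powr d s * s ^ n = pos_powr (d + real n) s"
proof (cases "s > 0")
  case True
  hence "s powr (d - 1) * s powr real n = s powr (d + real n - 1)"
    by (simp flip: powr_add add: add_diff_eq add.commute)
  thus ?thesis using True by (simp add: pos_powr_def powr_realpow)
qed (auto simp: pos_powr_def)

text \<open>Euler's integral, rescaled from \<open>r = 1\<close> by the substitution
  \<open>s \<mapsto> r * s\<close>.\<close>

lemma has_bochner_integral_pos_powr_exp:
  assumes "d > 0" "r > 0"
  shows "has_bochner_integral lborel (\<lambda>s. pos_powr d s * exp (- r * s)) (Gamma d / r powr d)"
proof -
  have "(\<integral>\<^sup>+s. ennreal (pos_powr d s * exp (- s)) \<partial>lborel) = ennreal (Gamma d)"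
    unfolding Gamma_conv_nn_integral_real[OF assms(1)]
    by (intro nn_integral_cong) (auto simp: pos_powr_def indicator_def exp_minus field_simps)
  hence "has_bochner_integral lborel (\<lambda>s. pos_powr d s * exp (- s)) (Gamma d)"
    using assms Gamma_real_pos[of d]
    by (intro has_bochner_integral_nn_integral) (auto simp: pos_powr_nonneg)
  hence I: "integrable lborel (\<lambda>s. pos_powr d s * exp (- s))"
     "(\<integral>s. pos_powr d s * exp (- s) \<partial>lborel) = Gamma d"
    by (auto simp: has_bochner_integral_iff)
  have eq: "pos_powr d (0 + r * s) * exp (- (0 + r * s)) = r powr (d - 1) * (pos_powr d s * exp (- r * s))" for s
    using assms by (auto simp: pos_powr_def indicator_def powr_mult zero_less_mult_iff)
  have "integrable lborel (\<lambda>s. r powr (d - 1) * (pos_powr d s * exp (- r * s)))"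
    using lborel_integrable_real_affine[OF I(1), of r 0] assms unfolding eq by simp
  from integrable_mult_right[OF this, of "1 / r powr (d - 1)"]
  have "integrable lborel (\<lambda>s. pos_powr d s * exp (- r * s))"
    using assms by simp
  moreover have "Gamma d = r * (r powr (d - 1) * (\<integral>s. pos_powr d s * exp (- r * s) \<partial>lborel))"
    using lborel_integral_real_affine[of r "\<lambda>s. pos_powr d s * exp (- s)" 0] assms I(2)
    unfolding eq by simp
  moreover have "r * r powr (d - 1) = r powr d"
    using assms by (simp add: powr_mult_base)
  ultimately show ?thesis
    using assms by (auto simp: has_bochner_integral_iff field_simps)
qed

lemma integral_pos_powr_exp_complex:
  assumes d: "d > 0" and z: "Re z > 0"
  shows "(\<integral>s. of_real (pos_powr d s) * exp (- of_real s * z) \<partial>lborel) =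
         of_real (Gamma d) * z powr (- of_real d)"
proof -
  \<comment> \<open>For \<open>r\<close> this large \<open>norm (1 - z / r) < 1\<close>, so expanding \<open>exp (s * r * u)\<close> and integrating
    termwise gives the binomial series of \<open>(1 - u) powr (-d)\<close>.\<close>
  define r where "r = (norm z)\<^sup>2 / (2 * Re z) + 1"
  have r: "r > 0" using z by (auto simp: r_def intro!: add_nonneg_pos)
  define u where "u = 1 - z / of_real r"
  have z_eq: "z = of_real r * (1 - u)" using r by (simp add: u_def)
  \<comment> \<open>\<open>norm u < 1\<close> places \<open>z\<close> in the disc of radius
    \<open>r\<close> around \<open>r\<close>, that is
    \<open>(norm z)\<^sup>2 < 2 * r * Re z\<close>; this dictates the choice of
    \<open>r\<close>.\<close>
  have u: "norm u < 1"
  proof -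
    have "(norm z)\<^sup>2 < 2 * Re z * r"
      using z by (simp add: r_def field_simps)
    hence "(norm (of_real r - z))\<^sup>2 < r\<^sup>2"
      unfolding cmod_power2 by (simp add: power2_eq_square algebra_simps)
    hence "norm (of_real r - z) < r"
      using r by (simp add: power_less_imp_less_base)
    moreover have "u = (of_real r - z) / of_real r"
      using r by (simp add: u_def field_simps)
    ultimately show ?thesis using r by (simp add: norm_divide)
  qed
  define f where "f = (\<lambda>n s. (of_real r * u) ^ n / fact n * of_real (pos_powr (d + real n) s * exp (- r * s)))"
  define C where "C = Gamma d / r powr d"
  have C: "C > 0" using d r by (simp add: C_def)
  \<comment> \<open>The factor \<open>s ^ n\<close> of the exponential series raises
    \<open>d\<close> to \<open>d + n\<close>, and
    \<open>pochhammer d n = Gamma (d + n) / Gamma d\<close> produces the binomial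
    coefficients.\<close>
  have hbi: "has_bochner_integral lborel (\<lambda>s. pos_powr (d + real n) s * exp (- r * s))
      (C * pochhammer d n / r ^ n)" for n
  proof -
    have "d \<notin> \<int>\<^sub>\<le>\<^sub>0" using d by (auto elim!: nonpos_Ints_cases)
    hence "C * pochhammer d n / r ^ n = Gamma (d + real n) / r powr (d + real n)"
      using r d by (simp add: C_def pochhammer_Gamma Gamma_eq_zero_iff powr_add powr_realpow)
    thus ?thesis using has_bochner_integral_pos_powr_exp[of "d + real n" r] d r by simp
  qed
  have f_int: "integrable lborel (f n)" for n
    unfolding f_def using hbi[of n] by (intro integrable_mult_right integrable_of_real) (simp add: has_bochner_integral_iff)
  have f_integral: "(\<integral>s. f n s \<partial>lborel) = of_real C * ((of_real (- d) gchoose n) * (- u) ^ n)" for n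
  proof -
    have "(\<integral>s. f n s \<partial>lborel) = (of_real r * u) ^ n / fact n * of_real (C * pochhammer d n / r ^ n)"
      unfolding f_def has_bochner_integral_integral_eq[OF hbi[of n], symmetric]
      by (simp only: integral_mult_right_zero integral_complex_of_real)
    also have "\<dots> = of_real C * ((of_real (- d) gchoose n) * (- u) ^ n)"
      using r by (simp add: gbinomial_pochhammer power_mult_distrib field_simps pochhammer_of_real
          flip: power_mult_distrib)
    finally show ?thesis .
  qed
  have norm_f: "norm (f n s) = (r * norm u) ^ n / fact n * (pos_powr (d + real n) s * exp (- r * s))" for n s
    unfolding f_def norm_mult norm_divide norm_power norm_of_real using r
    by (simp add: pos_powr_nonneg abs_mult)
  have f_norm_integral: "(\<integral>s. norm (f n s) \<partial>lborel) = C * ((- d gchoose n) * (- norm u) ^ n)" for n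
  proof -
    have "(\<integral>s. norm (f n s) \<partial>lborel) = (r * norm u) ^ n / fact n * (C * pochhammer d n / r ^ n)"
      unfolding norm_f using hbi[of n] by (simp add: has_bochner_integral_iff)
    also have "\<dots> = C * ((- d gchoose n) * (- norm u) ^ n)"
      using r by (simp add: gbinomial_pochhammer power_mult_distrib field_simps
          flip: power_mult_distrib)
    finally show ?thesis .
  qed
  have sums: "(\<lambda>n. f n s) sums (of_real (pos_powr d s) * exp (- of_real s * z))" for s
  proof -
    have "(\<lambda>n. (of_real s * of_real r * u) ^ n /\<^sub>R fact n) sums exp (of_real s * of_real r * u)"
      by (rule exp_converges)
    hence "(\<lambda>n. of_real (pos_powr d s * exp (- r * s)) * ((of_real s * of_real r * u) ^ n /\<^sub>R fact n)) sums
        (of_real (pos_powr d s * exp (- r * s)) * exp (of_real s * of_real r * u))"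
      by (rule sums_mult)
    also have "of_real (pos_powr d s * exp (- r * s)) * exp (of_real s * of_real r * u) =
        of_real (pos_powr d s) * exp (- of_real s * z)"
      unfolding z_eq by (simp add: algebra_simps flip: exp_of_real exp_add)
    also have "(\<lambda>n. of_real (pos_powr d s * exp (- r * s)) * ((of_real s * of_real r * u) ^ n /\<^sub>R fact n)) = (\<lambda>n. f n s)"
      unfolding f_def pos_powr_mult_power[symmetric]
      by (simp add: scaleR_conv_of_real power_mult_distrib field_simps fun_eq_iff)
    finally show ?thesis .
  qed
  have summ_pt: "summable (\<lambda>n. norm (f n s))" for s
  proof -
    have "summable (\<lambda>n. pos_powr d s * exp (- r * s) * ((s * r * norm u) ^ n /\<^sub>R fact n))"
      by (intro summable_mult summable_exp_generic)
    also have "(\<lambda>n. pos_powr d s * exp (- r * s) * ((s * r * norm u) ^ n /\<^sub>R fact n)) = (\<lambda>n. norm (f n s))"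
      unfolding norm_f pos_powr_mult_power[symmetric]
      by (simp add: power_mult_distrib field_simps fun_eq_iff)
    finally show ?thesis .
  qed
  \<comment> \<open>The integrals of the norms form the same binomial series with
    \<open>norm u\<close> in place of \<open>u\<close>; its convergence justifies integrating
    termwise.\<close>
  have summ_int: "summable (\<lambda>n. \<integral>s. norm (f n s) \<partial>lborel)"
    unfolding f_norm_integral
    using gen_binomial_real[of "- norm u" "- d"] u by (intro summable_mult) (auto simp: sums_iff)
  have "(\<integral>s. of_real (pos_powr d s) * exp (- of_real s * z) \<partial>lborel) = (\<integral>s. (\<Sum>n. f n s) \<partial>lborel)"
    using sums by (simp add: sums_iff)
  also have "\<dots> = (\<Sum>n. \<integral>s. f n s \<partial>lborel)"
    by (rule integral_suminf[OF f_int _ summ_int]) (use summ_pt in auto)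
  also have "\<dots> = of_real C * (1 - u) powr (- of_real d)"
  proof -
    have "(\<lambda>n. (of_real (- d) gchoose n) * (- u) ^ n) sums (1 + (- u)) powr (of_real (- d) :: complex)"
      using u by (intro gen_binomial_complex) auto
    from sums_mult[OF this, of "of_real C"] show ?thesis
      unfolding f_integral by (simp add: sums_iff)
  qed
  also have "\<dots> = of_real (Gamma d) * z powr (- of_real d)"
  proof -
    \<comment> \<open>The principal power may be split over this product because the factor
      \<open>r\<close> is a positive real.\<close>
    have "z powr (- of_real d) = of_real r powr (- of_real d) * (1 - u) powr (- of_real d)"
      unfolding z_eq using r by (subst powr_times_real_left) (auto simp: )
    also have "(of_real r :: complex) powr (- of_real d) = of_real (r powr (- d))"
      using r by (simp add: powr_of_real flip: of_real_minus)
    finally show ?thesis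
      using r by (simp add: C_def powr_minus field_simps)
  qed
  finally show ?thesis .
qed

text \<open>A majorant that factorises is integrable on the product space, as Fubini's theorem
  requires. It serves to interchange the vertical line integral with the Laplace integral, where the
  modulus of the integrand splits in this way.\<close>

lemma Fubini_dominated_kernel:
  fixes k :: "real \<Rightarrow> real \<Rightarrow> complex" and u v :: "real \<Rightarrow> real"
  assumes [measurable]: "(\<lambda>(x, s). k x s) \<in> borel_measurable (lborel \<Otimes>\<^sub>M lborel)"
    and u: "integrable lborel u" and v: "integrable lborel v"
    and bound: "\<And>x s. norm (k x s) \<le> u x * v s"
  shows "(\<integral>x. (\<integral>s. k x s \<partial>lborel) \<partial>lborel) = (\<integral>s. (\<integral>x. k x s \<partial>lborel) \<partial>lborel)"
    and "integrable lborel (\<lambda>s. \<integral>x. k x s \<partial>lborel)"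
proof -
  note [measurable] = borel_measurable_integrable[OF u] borel_measurable_integrable[OF v]
  have "integrable (lborel \<Otimes>\<^sub>M lborel) (\<lambda>(x, s). u x * v s)"
    by (rule lborel_pair.Fubini_integrable) (use u v in \<open>auto simp: abs_mult\<close>)
  hence int: "integrable (lborel \<Otimes>\<^sub>M lborel) (\<lambda>(x, s). k x s)"
    by (rule Bochner_Integration.integrable_bound)
       (use bound in \<open>auto intro!: AE_I2 order_trans[OF bound]\<close>)
  show "(\<integral>x. (\<integral>s. k x s \<partial>lborel) \<partial>lborel) = (\<integral>s. (\<integral>x. k x s \<partial>lborel) \<partial>lborel)"
    using lborel_pair.Fubini_integral[OF int] by simp
  show "integrable lborel (\<lambda>s. \<integral>x. k x s \<partial>lborel)"
    using lborel_pair.integrable_snd[OF int] by simp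
qed

section \<open>Convolution of a power with an exponentially concentrated kernel\<close>

text \<open>From \<open>1 + y \<le> M * exp (y / M)\<close> for \<open>M \<ge> 1\<close>, raised to
  the power \<open>m\<close>; the choice \<open>M \<ge> m / \<delta>\<close> lets the decaying
  exponential absorb the growing one.\<close>

lemma powr_mult_exp_bounded:
  fixes m \<delta> :: real
  assumes "m \<ge> 0" "\<delta> > 0"
  obtains A where "A > 0" "\<And>y. y \<ge> 0 \<Longrightarrow> (1 + y) powr m * exp (- \<delta> * y) \<le> A"
proof -
  define M where "M = max 1 (m / \<delta>)"
  have M: "M \<ge> 1" "m / M \<le> \<delta>"
    using assms by (auto simp: M_def field_simps max_def)
  have "(1 + y) powr m * exp (- \<delta> * y) \<le> M powr m" if y: "y \<ge> 0" for y
  proof -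
    have "1 + y \<le> M * (1 + y / M)"
      using M y by (simp add: field_simps)
    also have "\<dots> \<le> M * exp (y / M)"
      using M by (intro mult_left_mono exp_ge_add_one_self) auto
    finally have "(1 + y) powr m \<le> (M * exp (y / M)) powr m"
      using assms y by (intro powr_mono2) auto
    also have "\<dots> = M powr m * exp (m / M * y)"
      using M by (simp add: powr_mult exp_powr_real mult.commute)
    also have "\<dots> \<le> M powr m * exp (\<delta> * y)"
      using mult_right_mono[OF M(2) y] by (intro mult_left_mono) auto
    finally show ?thesis
      by (simp add: exp_minus field_simps)
  qed
  moreover have "M powr m > 0" using M by simp
  ultimately show ?thesis using that by blast
qed

lemma exp_decay_powr_bounded:
  fixes m \<delta> :: real
  assumes "\<delta> > 0"
  obtains A where "A > 0" "\<And>y. y \<ge> 1 \<Longrightarrow> exp (- \<delta> * y) \<le> A * y powr m"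
proof -
  obtain A where A: "A > 0" "\<And>y. y \<ge> 0 \<Longrightarrow> (1 + y) powr \<bar>m\<bar> * exp (- \<delta> * y) \<le> A"
    using powr_mult_exp_bounded[of "\<bar>m\<bar>" \<delta>] assms by auto
  have "exp (- \<delta> * y) \<le> A * y powr m" if y: "y \<ge> 1" for y
  proof -
    have "y powr (- m) * exp (- \<delta> * y) \<le> (1 + y) powr \<bar>m\<bar> * exp (- \<delta> * y)"
      using y by (intro mult_right_mono order_trans[OF powr_mono[of _ "\<bar>m\<bar>"] powr_mono2]) auto
    also have "\<dots> \<le> A" using A y by simp
    finally show ?thesis using y by (simp add: powr_minus field_simps)
  qed
  thus ?thesis using that A by blast
qed

text \<open>Mean value theorem. For \<open>y\<close> between \<open>s\<close> and \<open>x\<close>,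
  both \<open>y / x\<close> and \<open>x / y\<close> are at most
  \<open>W = 2 * (1 + \<bar>x - s\<bar>)\<close>, so \<open>y powr (p - 1)\<close> is controlled
  whatever the sign of \<open>p - 1\<close>. The extra 1 in the exponent pays for the length
  \<open>\<bar>s - x\<bar>\<close>.\<close>

lemma powr_diff_le:
  fixes s x p :: real
  assumes x: "x \<ge> 1" and s: "s \<ge> x / 2"
  shows "\<bar>s powr p - x powr p\<bar> \<le> \<bar>p\<bar> * x powr (p - 1) * (2 * (1 + \<bar>x - s\<bar>)) powr (\<bar>p - 1\<bar> + 1)"
proof -
  define W where "W = 2 * (1 + \<bar>x - s\<bar>)"
  have W: "W \<ge> 2" by (simp add: W_def)
  have "norm (s powr p - x powr p) \<le> (\<bar>p\<bar> * x powr (p - 1) * W powr \<bar>p - 1\<bar>) * norm (s - x)"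
  proof (rule field_differentiable_bound)
    show "convex {min s x..max s x}" by simp
    fix y assume y: "y \<in> {min s x..max s x}"
    hence y2: "y \<ge> x / 2" "y \<le> x + \<bar>x - s\<bar>" using x s by (auto simp: min_def max_def split: if_splits)
    hence ypos: "y > 0" using x by simp
    show "((\<lambda>y. y powr p) has_field_derivative (p * y powr (p - 1))) (at y within {min s x..max s x})"
      using ypos by (auto intro!: derivative_eq_intros simp: powr_diff)
    define v where "v = y / x"
    have "inverse v \<le> 2" and v: "v > 0"
      using y2 x ypos by (auto simp: v_def field_simps)
    hence vW: "inverse v \<le> W" using W by simp
    have "\<bar>x - s\<bar> \<le> x * \<bar>x - s\<bar>"
      using x by (simp add: mult_le_cancel_right1)
    hence "y \<le> x * (1 + \<bar>x - s\<bar>)" using y2 by (simp add: algebra_simps)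
    also have "\<dots> \<le> x * W" using x by (simp add: W_def)
    finally have v': "v \<le> W" using x by (simp add: v_def field_simps)
    have "v powr (p - 1) \<le> W powr \<bar>p - 1\<bar>"
    proof (cases "p \<ge> 1")
      case True
      thus ?thesis using v v' by (auto intro: powr_mono2)
    next
      case False
      have "v powr (p - 1) = inverse v powr (1 - p)"
        using v by (simp add: powr_def ln_inverse algebra_simps)
      also have "\<dots> \<le> W powr (1 - p)"
        using False v vW by (intro powr_mono2) auto
      finally show ?thesis using False by simp
    qed
    moreover have "y powr (p - 1) = x powr (p - 1) * v powr (p - 1)"
      using x ypos by (simp add: v_def powr_divide)
    ultimately have "y powr (p - 1) \<le> x powr (p - 1) * W powr \<bar>p - 1\<bar>"
      using x by simp
    thus "norm (p * y powr (p - 1)) \<le> \<bar>p\<bar> * x powr (p - 1) * W powr \<bar>p - 1\<bar>"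
      by (simp add: abs_mult mult.assoc mult_left_mono)
  qed auto
  also have "\<dots> \<le> (\<bar>p\<bar> * x powr (p - 1) * W powr \<bar>p - 1\<bar>) * W"
    by (intro mult_left_mono) (simp_all add: W_def abs_if)
  also have "\<dots> = \<bar>p\<bar> * x powr (p - 1) * W powr (\<bar>p - 1\<bar> + 1)"
    using W by (simp add: powr_add)
  finally show ?thesis by (simp add: W_def)
qed

text \<open>The integral is split at \<open>s = x / 2\<close>. To the right,
  \<open>powr_diff_le\<close> gains a factor \<open>1 / x\<close> and the exponential absorbs the
  polynomial in \<open>\<bar>x - s\<bar>\<close>. To the left, \<open>h (x - s)\<close> is
  exponentially small in \<open>x\<close>, so the two powers can be estimated separately.\<close>

lemma pos_powr_convolution_bound:
  fixes h :: "real \<Rightarrow> complex" and d \<delta> C :: real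
  assumes d: "d > 0" and \<delta>: "\<delta> > 0"
    and h: "\<And>y. norm (h y) \<le> C * exp (- \<delta> * \<bar>y\<bar>)"
  obtains B where "\<And>x. x \<ge> 1 \<Longrightarrow>
    norm (\<integral>s. of_real (pos_powr d s - x powr (d - 1) * pos_powr 1 s) * h (x - s) \<partial>lborel)
      \<le> B * x powr (d - 2)"
proof -
  define p where "p = d - 1"
  define m where "m = \<bar>p - 1\<bar> + 1"
  have C: "C \<ge> 0" using order_trans[OF norm_ge_zero h[of 0]] by simp
  \<comment> \<open>\<open>m\<close> powers absorb the factor from \<open>powr_diff_le\<close>; the
    other two leave the integrable bound \<open>1 / (1 + (x - s)\<^sup>2)\<close>.\<close>
  obtain A1 where A1: "A1 > 0" "\<And>y. y \<ge> 0 \<Longrightarrow> (1 + y) powr (m + 2) * exp (- \<delta> * y) \<le> A1"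
    using powr_mult_exp_bounded[of "m + 2" \<delta>] \<delta> by (auto simp: m_def)
  \<comment> \<open>On the left part the term with \<open>s powr p\<close> carries no power of
    \<open>x\<close> and needs all of \<open>x powr (d - 2)\<close> from the exponential; the term
    with \<open>x powr p\<close> needs only \<open>1 / x\<close>, which is
    \<open>A3\<close>.\<close>
  obtain A2 where A2: "A2 > 0" "\<And>y. y \<ge> 1 \<Longrightarrow> exp (- (\<delta> / 4) * y) \<le> A2 * y powr (d - 2)"
    using exp_decay_powr_bounded[of "\<delta> / 4" "d - 2"] \<delta> by auto
  obtain A3 where A3: "A3 > 0" "\<And>y. y \<ge> 1 \<Longrightarrow> exp (- (\<delta> / 4) * y) \<le> A3 * y powr (- 1)"
    using exp_decay_powr_bounded[of "\<delta> / 4" "- 1"] \<delta> by auto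
  define I where "I = (\<integral>y. 1 / (1 + y\<^sup>2) \<partial>(lborel :: real measure))"
  define J where "J = Gamma d / (\<delta> / 2) powr d"
  have J: "has_bochner_integral lborel (\<lambda>s. pos_powr d s * exp (- (\<delta> / 2) * s)) J"
    unfolding J_def using d \<delta> by (intro has_bochner_integral_pos_powr_exp) auto
  have J1: "has_bochner_integral lborel (\<lambda>s. pos_powr 1 s * exp (- (\<delta> / 2) * s)) (2 / \<delta>)"
    using has_bochner_integral_pos_powr_exp[of 1 "\<delta> / 2"] \<delta> by simp
  have J_pos: "J \<ge> 0" using d \<delta> by (simp add: J_def)
  define B where "B = C * (\<bar>p\<bar> * 2 powr m * A1 * I + (A2 * J + A3 * (2 / \<delta>)))"
  have "norm (\<integral>s. of_real (pos_powr d s - x powr (d - 1) * pos_powr 1 s) * h (x - s) \<partial>lborel)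
      \<le> B * x powr (d - 2)" (is "norm (\<integral>s. ?f s \<partial>lborel) \<le> _") if x: "x \<ge> 1" for x
  proof -
    have Ix: "integrable lborel (\<lambda>s. 1 / (1 + (x - s)\<^sup>2))" "(\<integral>s. 1 / (1 + (x - s)\<^sup>2) \<partial>lborel) = I"
      using lborel_integrable_real_affine[OF integrable_inverse_1_plus_square_lborel, of "-1" x]
        lborel_integral_real_affine[of "-1" "\<lambda>s. 1 / (1 + s\<^sup>2)" x] by (auto simp: I_def)
    define E where "E = exp (- (\<delta> / 4) * x)"
    \<comment> \<open>The bounds for the two parts are nonnegative, so their sum is a single
      majorant for all \<open>s\<close>.\<close>
    define maj where "maj = (\<lambda>s. C * (\<bar>p\<bar> * x powr (p - 1) * (2 powr m * A1) * (1 / (1 + (x - s)\<^sup>2)) +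
        E * (pos_powr d s * exp (- (\<delta> / 2) * s) + x powr p * (pos_powr 1 s * exp (- (\<delta> / 2) * s)))))"
    have "has_bochner_integral lborel maj
       (C * (\<bar>p\<bar> * x powr (p - 1) * (2 powr m * A1) * I + E * (J + x powr p * (2 / \<delta>))))"
      unfolding maj_def using Ix J J1
      by (intro has_bochner_integral_mult_right has_bochner_integral_add)
         (auto simp: has_bochner_integral_iff)
    hence maj: "integrable lborel maj"
       "(\<integral>s. maj s \<partial>lborel) = C * (\<bar>p\<bar> * x powr (p - 1) * (2 powr m * A1) * I + E * (J + x powr p * (2 / \<delta>)))"
      by (auto simp: has_bochner_integral_iff)
    have le: "norm (?f s) \<le> maj s" for s
    proof (cases "s > 0")
      case False
      thus ?thesis using C A1 by (simp add: maj_def pos_powr_def E_def)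
    next
      case s: True
      have f: "norm (?f s) = \<bar>s powr p - x powr p\<bar> * norm (h (x - s))"
        using s by (simp add: pos_powr_def norm_mult p_def flip: of_real_diff of_real_mult)
      have "\<bar>s powr p - x powr p\<bar> * exp (- \<delta> * \<bar>x - s\<bar>) \<le>
          \<bar>p\<bar> * x powr (p - 1) * (2 powr m * A1) * (1 / (1 + (x - s)\<^sup>2)) +
          E * (pos_powr d s * exp (- (\<delta> / 2) * s) + x powr p * (pos_powr 1 s * exp (- (\<delta> / 2) * s)))"
        (is "_ \<le> ?m1 + ?m2")
      proof (cases "s \<ge> x / 2")
        case True
        define y where "y = \<bar>x - s\<bar>"
        have y: "y \<ge> 0" by (simp add: y_def)
        have "(1 + y) powr m * (1 + y)\<^sup>2 * exp (- \<delta> * y) \<le> A1"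
          using A1(2)[OF y] y by (simp add: powr_add)
        hence "(1 + y) powr m * exp (- \<delta> * y) \<le> A1 / (1 + y)\<^sup>2"
          using y by (simp add: field_simps)
        also have "\<dots> \<le> A1 / (1 + y\<^sup>2)"
          using y A1 by (intro divide_left_mono) (auto simp: power2_eq_square algebra_simps intro!: mult_pos_pos add_pos_nonneg)
        finally have *: "(1 + y) powr m * exp (- \<delta> * y) \<le> A1 / (1 + (x - s)\<^sup>2)"
          by (simp add: y_def)
        have "\<bar>s powr p - x powr p\<bar> * exp (- \<delta> * y) \<le>
            \<bar>p\<bar> * x powr (p - 1) * (2 * (1 + y)) powr m * exp (- \<delta> * y)"
          using powr_diff_le[OF x True, of p] by (intro mult_right_mono) (auto simp: y_def m_def)
        also have "\<dots> = \<bar>p\<bar> * x powr (p - 1) * 2 powr m * ((1 + y) powr m * exp (- \<delta> * y))"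
          by (simp only: powr_mult mult_ac)
        also have "\<dots> \<le> \<bar>p\<bar> * x powr (p - 1) * 2 powr m * (A1 / (1 + (x - s)\<^sup>2))"
          by (intro mult_left_mono *) auto
        also have "\<dots> = ?m1" by simp
        finally have "\<bar>s powr p - x powr p\<bar> * exp (- \<delta> * y) \<le> ?m1" .
        moreover have "?m2 \<ge> 0" by (simp add: E_def pos_powr_nonneg)
        ultimately show ?thesis by (simp add: y_def)
      next
        case False
        \<comment> \<open>For \<open>s \<le> x / 2\<close> one has
          \<open>x - s \<ge> x / 4 + s / 2\<close>: the first summand yields the smallness
          \<open>E\<close>, the second keeps integrability in \<open>s\<close>.\<close>
        have "\<delta> * s \<le> \<delta> * (x / 2)"
          using False \<delta> by (intro mult_left_mono) auto
        hence "- \<delta> * \<bar>x - s\<bar> \<le> - (\<delta> / 4) * x + (- (\<delta> / 2) * s)"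
          using False s by (simp add: algebra_simps)
        hence "exp (- \<delta> * \<bar>x - s\<bar>) \<le> E * exp (- (\<delta> / 2) * s)"
          unfolding E_def exp_add[symmetric] by simp
        moreover have "\<bar>s powr p - x powr p\<bar> \<le> s powr p + x powr p"
          using powr_ge_zero[of s p] powr_ge_zero[of x p] by linarith
        ultimately have "\<bar>s powr p - x powr p\<bar> * exp (- \<delta> * \<bar>x - s\<bar>) \<le>
            (s powr p + x powr p) * (E * exp (- (\<delta> / 2) * s))"
          by (intro mult_mono) auto
        also have "\<dots> = ?m2" using s by (simp add: pos_powr_def p_def algebra_simps)
        finally have "\<bar>s powr p - x powr p\<bar> * exp (- \<delta> * \<bar>x - s\<bar>) \<le> ?m2" .
        moreover have "?m1 \<ge> 0" using A1 by simp
        ultimately show ?thesis by simp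
      qed
      hence "C * (\<bar>s powr p - x powr p\<bar> * exp (- \<delta> * \<bar>x - s\<bar>)) \<le> maj s"
        unfolding maj_def using C by (rule mult_left_mono)
      moreover have "norm (?f s) \<le> \<bar>s powr p - x powr p\<bar> * (C * exp (- \<delta> * \<bar>x - s\<bar>))"
        unfolding f by (intro mult_left_mono h) auto
      ultimately show ?thesis by (simp add: mult_ac)
    qed
    have "norm (\<integral>s. ?f s \<partial>lborel) \<le> (\<integral>s. norm (?f s) \<partial>lborel)"
      by (rule integral_norm_bound)
    also have "\<dots> \<le> (\<integral>s. maj s \<partial>lborel)"
      using maj(1) le by (rule integral_mono') (rule order_trans[OF norm_ge_zero le])
    also have "\<dots> \<le> C * (\<bar>p\<bar> * x powr (p - 1) * (2 powr m * A1) * I + (A2 * J + A3 * (2 / \<delta>)) * x powr (d - 2))"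
    proof -
      have "E * J \<le> (A2 * x powr (d - 2)) * J"
        using A2(2)[OF x] J_pos unfolding E_def by (intro mult_right_mono) auto
      moreover have "E * (x powr p * (2 / \<delta>)) \<le> A3 * (2 / \<delta>) * x powr (d - 2)"
      proof -
        have "E * (x powr p * (2 / \<delta>)) \<le> (A3 * x powr (- 1)) * (x powr p * (2 / \<delta>))"
          using A3(2)[OF x] \<delta> unfolding E_def by (intro mult_right_mono) auto
        also have "\<dots> = A3 * (2 / \<delta>) * (x powr (- 1) * x powr p)"
          by (simp only: mult_ac)
        also have "x powr (- 1) * x powr p = x powr (d - 2)"
          by (simp only: p_def powr_add[symmetric]) simp
        finally show ?thesis .
      qed
      ultimately have "E * (J + x powr p * (2 / \<delta>)) \<le> (A2 * J + A3 * (2 / \<delta>)) * x powr (d - 2)"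
        by (simp add: algebra_simps)
      thus ?thesis unfolding maj(2) using C by (intro mult_left_mono add_left_mono) auto
    qed
    also have "\<dots> = B * x powr (d - 2)"
      by (simp add: B_def p_def algebra_simps)
    finally show ?thesis .
  qed
  thus ?thesis using that by blast
qed

section \<open>The inverse Laplace transform of a power of Gamma\<close>

text \<open>Without the factor \<open>1 / (2 * pi)\<close>, the inverse Laplace transform \<open>h\<close> of the introduction.\<close>

definition Gamma_kernel :: "real \<Rightarrow> real \<Rightarrow> real \<Rightarrow> complex" where
  "Gamma_kernel c \<sigma> y =
     (\<integral>x. exp (of_real y * Complex \<sigma> x) * Gamma_shift_pow c (Complex \<sigma> x) \<partial>lborel)"

lemma norm_exp_of_real_mult_le:
  fixes z :: complex
  assumes "\<bar>Re z\<bar> \<le> r"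
  shows "norm (exp (of_real y * z)) \<le> exp (\<bar>y\<bar> * r)"
proof -
  have "y * Re z \<le> \<bar>y\<bar> * \<bar>Re z\<bar>" by (metis abs_ge_self abs_mult)
  also have "\<dots> \<le> \<bar>y\<bar> * r" using assms by (rule mult_left_mono) auto
  finally show ?thesis by simp
qed

lemma integrable_Gamma_shift_pow:
  assumes "c > 0" "\<sigma> > -1"
  shows "integrable lborel (\<lambda>x. Gamma_shift_pow c (Complex \<sigma> x))"
proof -
  obtain K where K: "K > 0" "\<And>z. \<sigma> \<le> Re z \<Longrightarrow> Re z \<le> \<sigma> \<Longrightarrow>
      norm (Gamma_shift_pow c z) * ((1 + norm z) * (1 + (Im z)\<^sup>2)) \<le> K"
    using Gamma_shift_pow_decay[OF assms] by blast
  show ?thesis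
  proof (rule integrable_vertical_line)
    show "continuous_on {z. Re z = \<sigma>} (Gamma_shift_pow c)"
      using assms by (intro continuous_on_subset[OF holomorphic_on_imp_continuous_on[OF holomorphic_Gamma_shift_pow]]) auto
    fix x
    have "norm (Gamma_shift_pow c (Complex \<sigma> x)) * (1 * (1 + x\<^sup>2)) \<le>
        norm (Gamma_shift_pow c (Complex \<sigma> x)) * ((1 + norm (Complex \<sigma> x)) * (1 + x\<^sup>2))"
      by (intro mult_left_mono mult_right_mono) auto
    also have "\<dots> \<le> K" using K(2)[of "Complex \<sigma> x"] by simp
    finally show "norm (Gamma_shift_pow c (Complex \<sigma> x)) \<le> K / (1 + x\<^sup>2)"
      by (simp add: field_simps add_pos_nonneg)
  qed
qed

text \<open>The form of the shift used twice: with \<open>f z = z * exp (y * z)\<close>, which has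
  no residue, and with \<open>f z = exp (x * z)\<close>, which has residue 1. The residue is
  \<open>f 0\<close> because \<open>Gamma_shift_pow c 0 = 1\<close>.\<close>

lemma Gamma_shift_pow_line_shift:
  fixes f :: "complex \<Rightarrow> complex"
  assumes c: "c > 0" and sig: "-1 < \<sigma>1" "\<sigma>1 < 0" "0 < \<sigma>2"
    and holo: "f holomorphic_on {z. Re z > -1}"
    and bound: "\<And>z. \<sigma>1 \<le> Re z \<Longrightarrow> Re z \<le> \<sigma>2 \<Longrightarrow> norm (f z) \<le> L * (1 + norm z)"
  shows "(\<integral>x. f (Complex \<sigma>2 x) * Gamma_shift_pow c (Complex \<sigma>2 x) / Complex \<sigma>2 x \<partial>lborel) =
         (\<integral>x. f (Complex \<sigma>1 x) * Gamma_shift_pow c (Complex \<sigma>1 x) / Complex \<sigma>1 x \<partial>lborel) + 2 * pi * f 0"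
proof -
  obtain K where K: "K > 0" "\<And>z. \<sigma>1 \<le> Re z \<Longrightarrow> Re z \<le> \<sigma>2 \<Longrightarrow>
      norm (Gamma_shift_pow c z) * ((1 + norm z) * (1 + (Im z)\<^sup>2)) \<le> K"
    using Gamma_shift_pow_decay[OF c sig(1)] by blast
  have "L \<ge> 0" using order_trans[OF norm_ge_zero bound[of 0]] sig by simp
  have "norm (f z * Gamma_shift_pow c z) \<le> (L * K) / (1 + (Im z)\<^sup>2)"
    if z: "\<sigma>1 \<le> Re z" "Re z \<le> \<sigma>2" for z
  proof -
    have "norm (f z * Gamma_shift_pow c z) * (1 + (Im z)\<^sup>2) \<le>
        L * (1 + norm z) * norm (Gamma_shift_pow c z) * (1 + (Im z)\<^sup>2)"
      unfolding norm_mult by (intro mult_right_mono bound z) auto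
    also have "\<dots> = L * (norm (Gamma_shift_pow c z) * ((1 + norm z) * (1 + (Im z)\<^sup>2)))"
      by (simp add: mult_ac)
    also have "\<dots> \<le> L * K" by (intro mult_left_mono K z \<open>L \<ge> 0\<close>)
    finally show ?thesis by (simp add: field_simps add_pos_nonneg)
  qed
  moreover have "{z. \<sigma>1 \<le> Re z \<and> Re z \<le> \<sigma>2} \<subseteq> {z. Re z > -1}" using sig by auto
  ultimately show ?thesis
    using vertical_line_shift[of "{z. Re z > -1}" \<sigma>1 \<sigma>2 "\<lambda>z. f z * Gamma_shift_pow c z" "L * K"]
      sig open_halfspace_Re_gt[of "-1"] convex_halfspace_Re_gt[of "-1"]
      holomorphic_on_mult[OF holo holomorphic_Gamma_shift_pow[of c]]
    by simp
qed

lemma norm_Gamma_kernel_le: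
  "norm (Gamma_kernel c \<sigma> y) \<le> exp (y * \<sigma>) * (\<integral>x. norm (Gamma_shift_pow c (Complex \<sigma> x)) \<partial>lborel)"
proof -
  have "norm (Gamma_kernel c \<sigma> y) \<le>
      (\<integral>x. norm (exp (of_real y * Complex \<sigma> x) * Gamma_shift_pow c (Complex \<sigma> x)) \<partial>lborel)"
    unfolding Gamma_kernel_def by (rule integral_norm_bound)
  thus ?thesis by (simp add: norm_mult)
qed

lemma Gamma_kernel_shift:
  assumes c: "c > 0" and sig: "-1 < \<sigma>1" "\<sigma>1 < 0" "0 < \<sigma>2"
  shows "Gamma_kernel c \<sigma>2 y = Gamma_kernel c \<sigma>1 y"
proof -
  \<comment> \<open>The factor \<open>z\<close> cancels the pole at \<open>0\<close>, so the residue term vanishes.\<close>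
  have "(\<integral>x. (Complex \<sigma>2 x * exp (of_real y * Complex \<sigma>2 x)) * Gamma_shift_pow c (Complex \<sigma>2 x) / Complex \<sigma>2 x \<partial>lborel) =
        (\<integral>x. (Complex \<sigma>1 x * exp (of_real y * Complex \<sigma>1 x)) * Gamma_shift_pow c (Complex \<sigma>1 x) / Complex \<sigma>1 x \<partial>lborel)
          + of_real (2 * pi) * (0 * exp (of_real y * 0))"
  proof (rule Gamma_shift_pow_line_shift[OF c sig, where L = "exp (\<bar>y\<bar> * max \<bar>\<sigma>1\<bar> \<bar>\<sigma>2\<bar>)"])
    fix z assume z: "\<sigma>1 \<le> Re z" "Re z \<le> \<sigma>2"
    have "norm (z * exp (of_real y * z)) \<le> (1 + norm z) * exp (\<bar>y\<bar> * max \<bar>\<sigma>1\<bar> \<bar>\<sigma>2\<bar>)"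
      unfolding norm_mult using z by (intro mult_mono norm_exp_of_real_mult_le) auto
    thus "norm (z * exp (of_real y * z)) \<le> exp (\<bar>y\<bar> * max \<bar>\<sigma>1\<bar> \<bar>\<sigma>2\<bar>) * (1 + norm z)"
      by (simp add: mult.commute)
  qed (intro holomorphic_intros)
  moreover have "Complex \<sigma>1 x \<noteq> 0" "Complex \<sigma>2 x \<noteq> 0" for x
    using sig by (auto simp: complex_eq_iff)
  ultimately show ?thesis
    by (simp add: Gamma_kernel_def)
qed

text \<open>On the line \<open>Re z = \<sigma>\<close> the kernel is of size
  \<open>exp (y * \<sigma>)\<close>. For \<open>y \<ge> 0\<close> the line is moved to
  \<open>-\<delta>\<close>; for \<open>y < 0\<close> the line \<open>b\<close> already suffices
  because \<open>\<delta> \<le> b\<close>.\<close>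

lemma Gamma_kernel_decay:
  assumes c: "c > 0" and b: "b > 0" and \<delta>: "0 < \<delta>" "\<delta> < 1" "\<delta> \<le> b"
  obtains C where "C \<ge> 0" "\<And>y. norm (Gamma_kernel c b y) \<le> C * exp (- \<delta> * \<bar>y\<bar>)"
proof -
  define N where "N = (\<lambda>\<sigma>. \<integral>x. norm (Gamma_shift_pow c (Complex \<sigma> x)) \<partial>lborel)"
  have N: "N \<sigma> \<ge> 0" for \<sigma> unfolding N_def by simp
  have "norm (Gamma_kernel c b y) \<le> (N b + N (-\<delta>)) * exp (- \<delta> * \<bar>y\<bar>)" for y
  proof (cases "y \<ge> 0")
    case True
    have "norm (Gamma_kernel c b y) \<le> exp (- \<delta> * \<bar>y\<bar>) * N (-\<delta>)"
      using norm_Gamma_kernel_le[of c "-\<delta>" y] Gamma_kernel_shift[of c "-\<delta>" b y] assms True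
      by (simp add: N_def mult.commute)
    thus ?thesis using N[of b] by (simp add: algebra_simps add_increasing)
  next
    case False
    have "y * b \<le> y * \<delta>" using False \<delta> by (simp add: mult_left_mono_neg)
    hence "exp (y * b) * N b \<le> exp (- \<delta> * \<bar>y\<bar>) * N b"
      using False N by (intro mult_right_mono) (auto simp: mult.commute)
    hence "norm (Gamma_kernel c b y) \<le> exp (- \<delta> * \<bar>y\<bar>) * N b"
      using norm_Gamma_kernel_le[of c b y] by (simp add: N_def)
    thus ?thesis using N[of "-\<delta>"] by (simp add: algebra_simps add_increasing2)
  qed
  thus ?thesis using that N by (meson add_nonneg_nonneg)
qed

text \<open>The power of \<open>z\<close> is written as a Laplace integral and the integrals are
  interchanged. On \<open>Re z = b\<close> the exponential of \<open>(x - s) * z\<close> has modulus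
  \<open>exp (x * b) * exp (- b * s)\<close>, so the majorant factorises. Both \<open>d = c\<close>
  and \<open>d = 1\<close> occur later.\<close>

lemma pos_powr_Gamma_kernel_convolution:
  assumes c: "c > 0" and b: "b > 0" and d: "d > 0"
  shows "(\<integral>s. of_real (pos_powr d s) * Gamma_kernel c b (x - s) \<partial>lborel) =
     of_real (Gamma d) * (\<integral>u. exp (of_real x * Complex b u) *
        (Complex b u powr (- of_real d) * Gamma_shift_pow c (Complex b u)) \<partial>lborel)" (is ?th1)
    and "integrable lborel (\<lambda>s. of_real (pos_powr d s) * Gamma_kernel c b (x - s))" (is ?th2)
proof -
  have int: "integrable lborel (\<lambda>u. Gamma_shift_pow c (Complex b u))"
    using c b by (intro integrable_Gamma_shift_pow) auto
  note [measurable] = borel_measurable_integrable[OF int]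
  define k where "k = (\<lambda>u s. (exp (of_real x * Complex b u) * Gamma_shift_pow c (Complex b u)) *
      (of_real (pos_powr d s) * exp (- of_real s * Complex b u)))"
  have kx: "(\<integral>u. k u s \<partial>lborel) = of_real (pos_powr d s) * Gamma_kernel c b (x - s)" for s
  proof -
    have "k u s = of_real (pos_powr d s) * (exp (of_real (x - s) * Complex b u) * Gamma_shift_pow c (Complex b u))" for u
      by (simp add: k_def algebra_simps exp_diff exp_minus field_simps)
    thus ?thesis by (simp add: Gamma_kernel_def)
  qed
  have ks: "(\<integral>s. k u s \<partial>lborel) = of_real (Gamma d) * (exp (of_real x * Complex b u) *
        (Complex b u powr (- of_real d) * Gamma_shift_pow c (Complex b u)))" for u
    unfolding k_def using integral_pos_powr_exp_complex[OF d, of "Complex b u"] b by simp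
  note F = Fubini_dominated_kernel[of k "\<lambda>u. exp (x * b) * norm (Gamma_shift_pow c (Complex b u))"
      "\<lambda>s. pos_powr d s * exp (- b * s)"]
  have prem: "(\<lambda>(u, s). k u s) \<in> borel_measurable (lborel \<Otimes>\<^sub>M lborel)"
    "integrable lborel (\<lambda>u. exp (x * b) * norm (Gamma_shift_pow c (Complex b u)))"
    "integrable lborel (\<lambda>s. pos_powr d s * exp (- b * s))"
    "norm (k u s) \<le> (exp (x * b) * norm (Gamma_shift_pow c (Complex b u))) * (pos_powr d s * exp (- b * s))" for u s
    subgoal unfolding k_def by measurable
    subgoal using int by simp
    subgoal using has_bochner_integral_pos_powr_exp[OF d b] by (simp add: has_bochner_integral_iff)
    subgoal by (simp add: k_def norm_mult pos_powr_nonneg mult.commute)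
    done
  show ?th2 using F(2)[OF prem] by (simp add: kx)
  show ?th1 using F(1)[OF prem] by (simp add: kx ks)
qed

text \<open>For \<open>d = 1\<close> the transform is \<open>G(z) / z\<close>. Moving the line to
  \<open>-\<delta>\<close> collects \<open>2 * pi\<close> from the pole and leaves an integral of
  size \<open>exp (- \<delta> * x)\<close>, where \<open>norm z \<ge> \<delta>\<close>.\<close>

lemma Gamma_kernel_cumulative:
  assumes c: "c > 0" and b: "b > 0" and \<delta>: "0 < \<delta>" "\<delta> < 1"
  obtains D where
    "\<And>x. norm ((\<integral>s. of_real (pos_powr 1 s) * Gamma_kernel c b (x - s) \<partial>lborel) - 2 * of_real pi)
           \<le> D * exp (- \<delta> * x)"
proof -
  define N where "N = (\<integral>u. norm (Gamma_shift_pow c (Complex (-\<delta>) u)) \<partial>lborel)"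
  have int: "integrable lborel (\<lambda>u. Gamma_shift_pow c (Complex (-\<delta>) u))"
    using c \<delta> by (intro integrable_Gamma_shift_pow) auto
  have "norm ((\<integral>s. of_real (pos_powr 1 s) * Gamma_kernel c b (x - s) \<partial>lborel) - 2 * of_real pi)
           \<le> (N / \<delta>) * exp (- \<delta> * x)" for x
  proof -
    have "(\<integral>s. of_real (pos_powr 1 s) * Gamma_kernel c b (x - s) \<partial>lborel) =
        (\<integral>u. exp (of_real x * Complex b u) * (Complex b u powr (- of_real 1) * Gamma_shift_pow c (Complex b u)) \<partial>lborel)"
      using pos_powr_Gamma_kernel_convolution(1)[OF c b, of 1 x] by simp
    also have "\<dots> = (\<integral>u. exp (of_real x * Complex b u) * Gamma_shift_pow c (Complex b u) / Complex b u \<partial>lborel)"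
      by (intro Bochner_Integration.integral_cong) (use b in \<open>auto simp: powr_minus field_simps complex_eq_iff\<close>)
    also have "\<dots> = (\<integral>u. exp (of_real x * Complex (-\<delta>) u) * Gamma_shift_pow c (Complex (-\<delta>) u) / Complex (-\<delta>) u \<partial>lborel)
        + of_real (2 * pi) * exp (of_real x * 0)"
    proof (rule Gamma_shift_pow_line_shift[where L = "exp (\<bar>x\<bar> * max \<delta> b)"])
      fix z assume z: "- \<delta> \<le> Re z" "Re z \<le> b"
      have "norm (exp (of_real x * z)) \<le> exp (\<bar>x\<bar> * max \<delta> b) * 1"
        using norm_exp_of_real_mult_le[of z "max \<delta> b" x] z by auto
      also have "\<dots> \<le> exp (\<bar>x\<bar> * max \<delta> b) * (1 + norm z)"
        by (intro mult_left_mono) auto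
      finally show "norm (exp (of_real x * z)) \<le> exp (\<bar>x\<bar> * max \<delta> b) * (1 + norm z)" .
    qed (use assms in \<open>auto intro!: holomorphic_intros\<close>)
    finally have "norm ((\<integral>s. of_real (pos_powr 1 s) * Gamma_kernel c b (x - s) \<partial>lborel) - 2 * of_real pi) =
        norm (\<integral>u. exp (of_real x * Complex (-\<delta>) u) * Gamma_shift_pow c (Complex (-\<delta>) u) / Complex (-\<delta>) u \<partial>lborel)"
      by simp
    also have "\<dots> \<le> (\<integral>u. norm (exp (of_real x * Complex (-\<delta>) u) * Gamma_shift_pow c (Complex (-\<delta>) u) / Complex (-\<delta>) u) \<partial>lborel)"
      by (rule integral_norm_bound)
    also have "\<dots> \<le> (\<integral>u. exp (- \<delta> * x) / \<delta> * norm (Gamma_shift_pow c (Complex (-\<delta>) u)) \<partial>lborel)"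
    proof (rule integral_mono')
      fix u
      have "norm (exp (of_real x * Complex (-\<delta>) u) * Gamma_shift_pow c (Complex (-\<delta>) u) / Complex (-\<delta>) u) =
          exp (- \<delta> * x) * norm (Gamma_shift_pow c (Complex (-\<delta>) u)) / norm (Complex (-\<delta>) u)"
        by (simp add: norm_mult norm_divide mult.commute)
      also have "\<dots> \<le> exp (- \<delta> * x) * norm (Gamma_shift_pow c (Complex (-\<delta>) u)) / \<delta>"
        using abs_Re_le_cmod[of "Complex (-\<delta>) u"] \<delta> by (intro divide_left_mono mult_pos_pos) auto
      finally show "norm (exp (of_real x * Complex (-\<delta>) u) * Gamma_shift_pow c (Complex (-\<delta>) u) / Complex (-\<delta>) u)
          \<le> exp (- \<delta> * x) / \<delta> * norm (Gamma_shift_pow c (Complex (-\<delta>) u))" by simp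
    qed (use int \<delta> in auto)
    also have "\<dots> = (N / \<delta>) * exp (- \<delta> * x)"
      by (simp add: N_def)
    finally show ?thesis .
  qed
  thus ?thesis using that by blast
qed

lemma inverse_Laplace_asymptotic:
  assumes c: "c > 0" and b: "b > 0"
  obtains B where "\<And>x. x \<ge> 1 \<Longrightarrow>
    norm (of_real (Gamma c) * (\<integral>u. exp (of_real x * Complex b u) *
        (Complex b u powr (- of_real c) * Gamma_shift_pow c (Complex b u)) \<partial>lborel)
      - 2 * of_real pi * of_real (x powr (c - 1))) \<le> B * x powr (c - 2)"
proof -
  \<comment> \<open>The bound 1/2 keeps the line \<open>Re z = -\<delta>\<close> to the right of -1,
    where \<open>G\<close> is holomorphic; the bound \<open>b\<close> serves the decay for negative
    arguments.\<close>
  define \<delta> where "\<delta> = min b (1 / 2)"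
  have \<delta>: "0 < \<delta>" "\<delta> < 1" "\<delta> \<le> b" using b by (auto simp: \<delta>_def)
  obtain C where C: "\<And>y. norm (Gamma_kernel c b y) \<le> C * exp (- \<delta> * \<bar>y\<bar>)"
    using Gamma_kernel_decay[OF c b \<delta>] by blast
  obtain B where B: "\<And>x. x \<ge> 1 \<Longrightarrow>
      norm (\<integral>s. of_real (pos_powr c s - x powr (c - 1) * pos_powr 1 s) * Gamma_kernel c b (x - s) \<partial>lborel)
        \<le> B * x powr (c - 2)"
    using pos_powr_convolution_bound[OF c \<delta>(1) C] by blast
  obtain D where D: "\<And>x. norm ((\<integral>s. of_real (pos_powr 1 s) * Gamma_kernel c b (x - s) \<partial>lborel) - 2 * of_real pi)
           \<le> D * exp (- \<delta> * x)"
    using Gamma_kernel_cumulative[OF c b \<delta>(1,2)] by blast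
  have "D \<ge> 0" using order_trans[OF norm_ge_zero D[of 0]] by simp
  obtain A where A: "A > 0" "\<And>y. y \<ge> 1 \<Longrightarrow> exp (- \<delta> * y) \<le> A * y powr (- 1)"
    using exp_decay_powr_bounded[OF \<delta>(1), of "-1"] by blast
  have "norm (of_real (Gamma c) * (\<integral>u. exp (of_real x * Complex b u) *
        (Complex b u powr (- of_real c) * Gamma_shift_pow c (Complex b u)) \<partial>lborel)
      - 2 * of_real pi * of_real (x powr (c - 1))) \<le> (B + D * A) * x powr (c - 2)" if x: "x \<ge> 1" for x
  proof -
    define P where "P = (\<lambda>d. \<integral>s. of_real (pos_powr d s) * Gamma_kernel c b (x - s) \<partial>lborel)"
    define X where "X = x powr (c - 1)"
    note int = pos_powr_Gamma_kernel_convolution(2)[OF c b, of _ x]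
    have "(\<integral>s. of_real (pos_powr c s - X * pos_powr 1 s) * Gamma_kernel c b (x - s) \<partial>lborel) =
        (\<integral>s. of_real (pos_powr c s) * Gamma_kernel c b (x - s) -
              of_real X * (of_real (pos_powr 1 s) * Gamma_kernel c b (x - s)) \<partial>lborel)"
      by (simp add: algebra_simps)
    also have "\<dots> = P c - of_real X * P 1"
      unfolding P_def using int[of c] int[of 1] c
      by (subst Bochner_Integration.integral_diff) auto
    finally have 1: "norm (P c - of_real X * P 1) \<le> B * x powr (c - 2)"
      using B[OF x] by (simp add: X_def)
    have "norm (of_real X * (P 1 - 2 * of_real pi)) \<le> X * (D * exp (- \<delta> * x))"
      unfolding norm_mult P_def using D[of x] by (simp add: X_def mult_left_mono)
    also have "\<dots> \<le> X * (D * (A * x powr (- 1)))"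
      using A(2)[OF x] \<open>D \<ge> 0\<close> by (intro mult_left_mono) (auto simp: X_def)
    also have "\<dots> = D * A * (x powr (- 1) * X)"
      by (simp only: mult_ac)
    also have "x powr (- 1) * X = x powr (c - 2)"
      by (simp only: X_def powr_add[symmetric]) simp
    finally have 2: "norm (of_real X * (P 1 - 2 * of_real pi)) \<le> D * A * x powr (c - 2)" .
    \<comment> \<open>The first summand is the cost of freezing the power at \<open>s = x\<close>;
      the second is the error in the total mass, exponentially small up to the factor
      \<open>X\<close>.\<close>
    have "norm (P c - 2 * of_real pi * of_real X) =
        norm ((P c - of_real X * P 1) + of_real X * (P 1 - 2 * of_real pi))"
      by (simp add: algebra_simps)
    also have "\<dots> \<le> (B + D * A) * x powr (c - 2)"
      using norm_triangle_mono[OF 1 2] by (simp add: algebra_simps)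
    finally show ?thesis
      unfolding X_def P_def pos_powr_Gamma_kernel_convolution(1)[OF c b c] .
  qed
  thus ?thesis using that by blast
qed

section \<open>From the density to the inverse Laplace transform, and the final estimate\<close>

text \<open>Taking logarithms in the functional equation of \<open>Gamma\<close> leaves a multiple
  of \<open>2 * pi * \<i>\<close> open. Here the difference of the two sides has derivative zero on
  the half-plane, by the recurrence of \<open>Digamma\<close>, and it vanishes at 1.\<close>

lemma ln_Gamma_complex_plus1:
  fixes z :: complex
  assumes "Re z > 0"
  shows "ln_Gamma (1 + z) = ln_Gamma z + ln z"
proof -
  define f where "f = (\<lambda>z::complex. ln_Gamma (1 + z) - ln_Gamma z - ln z)"
  have "\<exists>k. \<forall>z\<in>{z. Re z > 0}. f z = k"
  proof (rule has_field_derivative_zero_constant)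
    show "convex {z. Re z > 0}" by (rule convex_halfspace_Re_gt)
    fix z :: complex assume z: "z \<in> {z. Re z > 0}"
    hence nz: "z \<noteq> 0" "z \<notin> \<real>\<^sub>\<le>\<^sub>0" "1 + z \<notin> \<real>\<^sub>\<le>\<^sub>0"
      by (auto simp: complex_nonpos_Reals_iff)
    have "(f has_field_derivative (Digamma (1 + z) - Digamma z - 1 / z)) (at z within {z. Re z > 0})"
      unfolding f_def using nz by (auto intro!: derivative_eq_intros simp: divide_inverse)
    also have "Digamma (1 + z) - Digamma z - 1 / z = 0"
      using nz Digamma_plus1[of z] by (simp add: add.commute)
    finally show "(f has_field_derivative 0) (at z within {z. Re z > 0})" .
  qed
  then obtain k where k: "\<And>z. Re z > 0 \<Longrightarrow> f z = k" by auto
  have "f 1 = 0"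
    using ln_Gamma_complex_conv_fact[of 2] by (simp add: f_def ln_Gamma_complex_1)
  hence "f z = 0" using k[of 1] k[OF assms] by simp
  thus ?thesis by (simp add: f_def algebra_simps)
qed

lemma exp_ln_Gamma_eq_Gamma_shift_pow:
  assumes "Re z > 0"
  shows "exp (of_real c * ln_Gamma z) = z powr (- of_real c) * Gamma_shift_pow c z"
proof -
  have "z \<noteq> 0" using assms by auto
  thus ?thesis
    unfolding Gamma_shift_pow_def ln_Gamma_complex_plus1[OF assms]
    by (simp add: powr_def algebra_simps flip: exp_add)
qed

lemma Gamma_quot_pow_eq:
  assumes "b > 0" "Re z > 0"
  shows "Gamma_quot_pow c b z = z powr (- of_real c) * Gamma_shift_pow c z / of_real (Gamma b powr c)"
proof -
  have "exp (of_real c * ln_Gamma (complex_of_real b)) = of_real (Gamma b powr c)"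
  proof -
    have "exp (of_real c * ln_Gamma (complex_of_real b)) = of_real (exp (c * ln_Gamma b))"
      using assms by (simp add: ln_Gamma_complex_of_real flip: exp_of_real)
    also have "exp (c * ln_Gamma b) = Gamma b powr c"
      using assms less_imp_neq[OF Gamma_real_pos[of b]] by (simp add: powr_def ln_Gamma_real_pos)
    finally show ?thesis .
  qed
  thus ?thesis
    using exp_ln_Gamma_eq_Gamma_shift_pow[OF assms(2)] by (simp add: Gamma_quot_pow_def exp_diff)
qed

text \<open>Replacing the integration variable by \<open>-u / a\<close> turns
  \<open>b - \<i> a x\<close> into \<open>Complex b u\<close>. Since \<open>ln t = - a * x\<close>
  with \<open>x = ln (1 / t) / a\<close>, the remaining power of \<open>t\<close> splits into
  \<open>t powr (b / a - 1)\<close> and \<open>exp (x * Complex b u)\<close>.\<close>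

lemma e_density_eq:
  assumes a: "a > 0" and b: "b > 0" and t: "t > 0"
  shows "e_density c a b t = of_real (t powr (b / a - 1) / (2 * pi * a * Gamma b powr c)) *
    (\<integral>u. exp (of_real (ln (1 / t) / a) * Complex b u) *
        (Complex b u powr (- of_real c) * Gamma_shift_pow c (Complex b u)) \<partial>lborel)"
proof -
  define x where "x = ln (1 / t) / a"
  have lnt: "ln t = - a * x" using a t by (simp add: x_def ln_div)
  define F where "F = (\<lambda>u. of_real t powr (\<i> * of_real u - 1) * Gamma_quot_pow c b (of_real b - \<i> * of_real a * of_real u))"
  define G where "G = (\<lambda>u. exp (of_real x * Complex b u) * (Complex b u powr (- of_real c) * Gamma_shift_pow c (Complex b u)))"
  have *: "F (0 + (- (1 / a)) * u) = of_real (t powr (b / a - 1) / Gamma b powr c) * G u" for u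
  proof -
    have eq: "of_real b - \<i> * of_real a * of_real (0 + (- (1 / a)) * u) = Complex b u"
      using a by (simp add: complex_eq_iff)
    have "of_real t powr (\<i> * of_real (0 + (- (1 / a)) * u) - 1) =
        exp ((\<i> * of_real (0 + (- (1 / a)) * u) - 1) * of_real (ln t))"
      using t by (simp add: powr_def Ln_of_real)
    also have "(\<i> * of_real (0 + (- (1 / a)) * u) - 1) * of_real (ln t) =
        of_real ((b / a - 1) * ln t) + of_real x * Complex b u"
      using a unfolding lnt by (simp add: complex_eq_iff field_simps)
    also have "exp \<dots> = of_real (t powr (b / a - 1)) * exp (of_real x * Complex b u)"
      using t by (simp add: exp_add powr_def flip: exp_of_real)
    finally show ?thesis
      unfolding F_def eq using Gamma_quot_pow_eq[OF b, of "Complex b u" c] b by (simp add: G_def)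
  qed
  have "(\<integral>u. F u \<partial>lborel) = \<bar>- (1 / a)\<bar> *\<^sub>R (\<integral>u. F (0 + (- (1 / a)) * u) \<partial>lborel)"
    using a by (intro lborel_integral_real_affine) auto
  also have "\<dots> = of_real (1 / a) * (of_real (t powr (b / a - 1) / Gamma b powr c) * (\<integral>u. G u \<partial>lborel))"
    unfolding * using a by (simp add: scaleR_conv_of_real)
  finally show ?thesis
    unfolding e_density_def F_def[symmetric] x_def[symmetric] G_def[symmetric]
    by (simp add: field_simps)
qed

theorem theorem2p3:
  fixes a b c :: real
  assumes "a > 0" and "b > 0" and "c > 0"
  shows "(\<lambda>t::real. e_density c a b t -
            complex_of_real (t powr (b / a - 1) / (a * Gamma b) powr c *
              (ln (1 / t) powr (c - 1) / Gamma c)))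
         \<in> O[at_right 0](\<lambda>t. complex_of_real (t powr (b / a - 1) * ln (1 / t) powr (c - 2)))"
proof -
  define J where "J = (\<lambda>x. \<integral>u. exp (of_real x * Complex b u) *
        (Complex b u powr (- of_real c) * Gamma_shift_pow c (Complex b u)) \<partial>lborel)"
  obtain B where B: "\<And>x. x \<ge> 1 \<Longrightarrow>
    norm (of_real (Gamma c) * J x - 2 * of_real pi * of_real (x powr (c - 1))) \<le> B * x powr (c - 2)"
    unfolding J_def using inverse_Laplace_asymptotic[OF assms(3,2)] by blast
  have G: "Gamma b > 0" "Gamma c > 0" "Gamma b \<noteq> 0" "Gamma c \<noteq> 0"
    using assms Gamma_real_pos[of b] Gamma_real_pos[of c] by linarith+
  define q where "q = 2 * pi * a * Gamma b powr c * Gamma c"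
  have q: "q > 0" unfolding q_def using assms G by (intro mult_pos_pos) auto
  \<comment> \<open>\<open>t \<le> exp (- a)\<close> means
    \<open>x = ln (1 / t) / a \<ge> 1\<close>, the range of the asymptotic estimate; rewriting
    \<open>x powr (c - 2)\<close> by \<open>ln (1 / t)\<close> produces
    \<open>a powr (2 - c)\<close>.\<close>
  have bound: "norm (e_density c a b t - complex_of_real (t powr (b / a - 1) / (a * Gamma b) powr c *
              (ln (1 / t) powr (c - 1) / Gamma c)))
      \<le> (B * a powr (2 - c) / q) * norm (complex_of_real (t powr (b / a - 1) * ln (1 / t) powr (c - 2)))"
    if t: "t > 0" "t \<le> exp (- a)" for t
  proof -
    define x where "x = ln (1 / t) / a"
    define T where "T = t powr (b / a - 1)"
    have "ln t \<le> - a" using t by (metis exp_gt_zero ln_exp ln_le_cancel_iff)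
    hence x: "x \<ge> 1" using assms t by (simp add: x_def ln_div field_simps)
    have L: "ln (1 / t) = a * x" using assms by (simp add: x_def)
    have T: "T > 0" using t by (simp add: T_def)
    have eq: "e_density c a b t - complex_of_real (T / (a * Gamma b) powr c * (ln (1 / t) powr (c - 1) / Gamma c)) =
        of_real (T / q) * (of_real (Gamma c) * J x - 2 * of_real pi * of_real (x powr (c - 1)))"
    proof -
      have "e_density c a b t = of_real (T / q) * (of_real (Gamma c) * J x)"
        using e_density_eq[OF assms(1,2) t(1), of c] G
        by (simp add: J_def x_def T_def q_def field_simps)
      \<comment> \<open>From \<open>ln (1 / t) = a * x\<close> comes a factor
        \<open>a powr (c - 1)\<close>, which reduces \<open>a powr c\<close> in the denominator to
        the single \<open>a\<close> in \<open>q\<close>.\<close>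
      moreover have "T / (a * Gamma b) powr c * (ln (1 / t) powr (c - 1) / Gamma c) =
          (T / q) * (2 * pi * x powr (c - 1))"
        using G assms x unfolding L by (simp add: q_def powr_mult powr_diff field_simps)
      ultimately show ?thesis by (simp add: algebra_simps)
    qed
    have "norm (of_real (T / q) * (of_real (Gamma c) * J x - 2 * of_real pi * of_real (x powr (c - 1))))
        \<le> (T / q) * (B * x powr (c - 2))"
      unfolding norm_mult using B[OF x] T q by (intro mult_mono) (auto simp: norm_divide)
    also have "x powr (c - 2) = a powr (2 - c) * ln (1 / t) powr (c - 2)"
      unfolding L using assms x by (simp add: powr_mult powr_diff field_simps)
    finally show ?thesis
      unfolding T_def[symmetric] eq using T by (simp add: field_simps norm_mult)
  qed
  have "eventually (\<lambda>t. t > 0 \<and> t \<le> exp (- a)) (at_right 0)"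
    using eventually_at_right_real[of 0 "exp (- a)"] by (auto elim: eventually_mono)
  hence "eventually (\<lambda>t. norm (e_density c a b t - complex_of_real (t powr (b / a - 1) / (a * Gamma b) powr c *
              (ln (1 / t) powr (c - 1) / Gamma c)))
      \<le> (B * a powr (2 - c) / q) * norm (complex_of_real (t powr (b / a - 1) * ln (1 / t) powr (c - 2)))) (at_right 0)"
    by eventually_elim (use bound in blast)
  thus ?thesis by (rule bigoI)
qed

end
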